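(* For every integer $k\ge 1$, $$-\frac{1}{4k+2}\pi^{2k}=\sum_{l=0}^{k-1}\sum_{n=1}^{\infty}\pi^{2k-2l-2}\frac{(2k)!\,(-1)^n(-1)^l}{(2k-2l-1)!\,(2n)^{2l+2}}+\sum_{l=0}^{k}\sum_{n=1}^{\infty}\frac{\pi^{2k-2l-1}(-1)^{n}(-1)^l(2k)!}{(2n-1)^{2l+1}(2k-2l)!}+\sum_{n=1}^{\infty}\frac{(-1)^k(-1)^n(2k)!}{\pi(2n-1)^{2k+1}}.$$
   Context: Here $\sum_{n=1}^{\infty}c_n$ denotes the limit of partial sums $\lim_{N\to\infty}\sum_{n=1}^{N}c_n$ of a series of real numbers (the series need not converge absolutely). *)

theory Defs
  imports Complex_Main
begin

end

theory Submission
  imports Defs "HOL-Analysis.Henstock_Kurzweil_Integration"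
    "HOL-Real_Asymp.Real_Asymp"
begin

text \<open>
  The identity is a Fourier series read off at a single point.  Let \<open>f\<close> be \<open>x ^ (2 * k)\<close> on
  \<open>(0, pi)\<close> and \<open>0\<close> on \<open>(-pi, 0)\<close>.  Its Fourier series converges at the interior point
  \<open>-pi / 2\<close> to \<open>f (-pi / 2) = 0\<close>.  The left-hand side of the theorem is minus the constant
  term of the series, and the right-hand side collects the other terms: at \<open>-pi / 2\<close> only the
  cosines of even frequency \<open>2 * n\<close> and the sines of odd frequency \<open>2 * n - 1\<close> survive, both
  with a sign \<open>(-1) ^ n\<close>, and repeated integration by parts writes the coefficients
  as finite sums over \<open>l\<close>.  The last single series comes from the boundary term at \<open>0\<close> in the
  sine coefficients; it equals the \<open>l = k\<close> term of the double sum before it, which is the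
  corresponding boundary term at \<open>pi\<close>.

  Convergence at that point is proved by hand.  Up to a factor \<open>1 / pi\<close>, the partial sums with
  evenly many frequencies are integrals of \<open>x ^ (2 * k)\<close> over \<open>[0, pi]\<close> against a translated Dirichlet kernel, which \<open>shifted_dirichlet_kernel\<close> puts in closed form.
  The denominator \<open>sin (x / 2 + pi / 4)\<close> has no zero on \<open>[0, pi]\<close>, so the integrals tend to \<open>0\<close>
  by the quantitative Riemann-Lebesgue estimate \<open>oscillatory_integral_bound\<close>.  The
  coefficients are \<open>even_power_cos_integral\<close> and \<open>even_power_sin_integral\<close>.  Each of the single
  series converges by Leibniz' criterion, so the finite sums over \<open>l\<close> may be pulled out of
  the infinite sum over \<open>n\<close>.
\<close>

section \<open>Oscillatory integrals\<close>

text \<open>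
  One integration by parts moves the derivative from the oscillating factor to \<open>g\<close> and gains
  a factor \<open>1 / w\<close>; the remaining terms are bounded independently of frequency and phase.
\<close>

lemma oscillatory_integral_bound:
  fixes g g' :: "real \<Rightarrow> real"
  assumes "a \<le> b"
    and deriv: "\<And>x. x \<in> {a..b} \<Longrightarrow> (g has_real_derivative g' x) (at x within {a..b})"
    and cont: "continuous_on {a..b} g'"
  obtains B where
    "\<And>w p. w > 0 \<Longrightarrow> \<bar>integral {a..b} (\<lambda>x. g x * sin (w * x + p))\<bar> \<le> B / w"
proof -
  obtain D where "\<forall>x\<in>{a..b}. \<bar>g' x\<bar> \<le> D"
    using compact_imp_bounded[OF compact_continuous_image[OF cont compact_Icc]]
    by (auto simp: bounded_iff)
  then have D: "\<bar>g' x\<bar> \<le> D" if "x \<in> {a..b}" for x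
    using that by blast
  have "\<bar>integral {a..b} (\<lambda>x. g x * sin (w * x + p))\<bar> \<le> (\<bar>g a\<bar> + \<bar>g b\<bar> + D * (b - a)) / w"
    if "w > 0" for w p
  proof -
    let ?h = "\<lambda>x. g' x * cos (w * x + p)"
    have cont_h: "continuous_on {a..b} ?h"
      by (intro continuous_intros cont)
    have int_h: "(?h has_integral integral {a..b} ?h) {a..b}"
      using cont_h by (intro integrable_integral integrable_continuous_real)
    have bound_h: "\<bar>integral {a..b} ?h\<bar> \<le> D * (b - a)"
    proof -
      have "norm (integral {a..b} ?h) \<le> D * (b - a)"
      proof (rule integral_bound[OF \<open>a \<le> b\<close> cont_h])
        fix x assume "x \<in> {a..b}"
        then show "norm (?h x) \<le> D"
          using mult_mono[OF D abs_cos_le_one[of "w * x + p"]] D[of x]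
          by (auto simp: abs_mult)
      qed
      then show ?thesis by simp
    qed
    define u where "u = (\<lambda>x. - (g x * cos (w * x + p)) / w)"
    have "(u has_real_derivative (g x * sin (w * x + p) - ?h x / w)) (at x within {a..b})"
      if "x \<in> {a..b}" for x
      unfolding u_def using \<open>w > 0\<close>
      by (auto intro!: derivative_eq_intros deriv[OF that] simp: field_simps)
    then have "((\<lambda>x. g x * sin (w * x + p) - ?h x / w) has_integral (u b - u a)) {a..b}"
      using \<open>a \<le> b\<close>
      by (intro fundamental_theorem_of_calculus)
         (auto simp: has_real_derivative_iff_has_vector_derivative)
    from has_integral_add[OF this has_integral_divide[OF int_h, of w]]
    have "integral {a..b} (\<lambda>x. g x * sin (w * x + p)) = u b - u a + integral {a..b} ?h / w"
      by (intro integral_unique) simp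
    also have "\<dots> = (g a * cos (w * a + p) - g b * cos (w * b + p) + integral {a..b} ?h) / w"
      by (simp add: u_def diff_divide_distrib add_divide_distrib)
    also have "\<bar>\<dots>\<bar> \<le> (\<bar>g a\<bar> + \<bar>g b\<bar> + D * (b - a)) / w"
    proof -
      have "\<bar>g x * cos y\<bar> \<le> \<bar>g x\<bar>" for x y
        by (simp add: abs_mult mult_left_le)
      from this[of a "w * a + p"] this[of b "w * b + p"] bound_h
      show ?thesis
        using \<open>w > 0\<close> by (simp add: divide_right_mono)
    qed
    finally show ?thesis .
  qed
  then show thesis by (rule that)
qed

section \<open>The Dirichlet kernel translated by a quarter period\<close>

text \<open>
  This is the Dirichlet kernel of order \<open>2 * M\<close> at \<open>x + pi / 2\<close>: translating by \<open>pi / 2\<close> turns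
  \<open>cos (2 * n * x)\<close> into \<open>(-1) ^ n * cos (2 * n * x)\<close> and \<open>cos ((2 * n - 1) * x)\<close> into
  \<open>(-1) ^ n * sin ((2 * n - 1) * x)\<close>.
\<close>

lemma shifted_dirichlet_kernel:
  fixes x :: real
  shows "2 * sin (x / 2 + pi / 4) * (1 / 2 + (\<Sum>n<M. (-1) ^ Suc n *
           (cos (2 * real (Suc n) * x) + sin ((2 * real (Suc n) - 1) * x))))
         = (-1) ^ M * sin ((2 * real M + 1 / 2) * x + pi / 4)"
proof (induction M)
  case 0
  show ?case by simp
next
  case (Suc M)
  \<comment> \<open>Product-to-sum formulas: the quarter turn hidden in \<open>t\<close> makes the term \<open>sin (A - t)\<close> cancel
     between cosine and sine, and what is left telescopes.\<close>
  define t where "t = x / 2 + pi / 4"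
  define A where "A = 2 * real (Suc M) * x"
  define B where "B = (2 * real (Suc M) - 1) * x"
  have cos_term: "2 * sin t * cos A = sin (A + t) - sin (A - t)"
    by (simp add: sin_add sin_diff)
  have sin_term: "2 * sin t * sin B = cos (B - t) - cos (B + t)"
    by (simp add: cos_add cos_diff)
  have "B - t = (2 * real M * x + t) - pi / 2"
    by (simp add: B_def t_def field_simps)
  then have minus: "cos (B - t) = sin (2 * real M * x + t)"
    by (simp only: cos_diff cos_pi_half sin_pi_half mult_zero_right mult_1_right add_0)
  have "B + t = (A - t) + pi / 2"
    by (simp add: A_def B_def t_def field_simps)
  then have plus: "cos (B + t) = - sin (A - t)"
    by (simp only: cos_add cos_pi_half sin_pi_half mult_zero_right mult_1_right diff_0)
  have IH: "2 * sin t * (1 / 2 + (\<Sum>n<M. (-1) ^ Suc n *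
           (cos (2 * real (Suc n) * x) + sin ((2 * real (Suc n) - 1) * x))))
         = (-1) ^ M * sin (2 * real M * x + t)"
    using Suc.IH by (simp add: t_def algebra_simps)
  have "2 * sin t * (1 / 2 + (\<Sum>n<Suc M. (-1) ^ Suc n *
           (cos (2 * real (Suc n) * x) + sin ((2 * real (Suc n) - 1) * x))))
      = 2 * sin t * (1 / 2 + (\<Sum>n<M. (-1) ^ Suc n *
           (cos (2 * real (Suc n) * x) + sin ((2 * real (Suc n) - 1) * x))))
        + (-1) ^ Suc M * (2 * sin t * cos A + 2 * sin t * sin B)"
    unfolding A_def B_def sum.lessThan_Suc by (simp only: algebra_simps)
  also have "\<dots> = (-1) ^ Suc M * sin (A + t)"
    unfolding IH cos_term sin_term minus plus by (simp add: algebra_simps)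
  also have "A + t = (2 * real (Suc M) + 1 / 2) * x + pi / 4"
    by (simp add: A_def t_def algebra_simps)
  finally show ?case
    by (simp only: t_def)
qed

text \<open>
  The right-hand side of the kernel identity, divided by \<open>2 * sin (x / 2 + pi / 4)\<close>, is a
  smooth factor times, up to sign, an oscillation of frequency \<open>2 * M + 1 / 2\<close>.
\<close>

lemma shifted_kernel_integral_tendsto_0:
  "(\<lambda>M. integral {0..pi} (\<lambda>x. x ^ j * (1 / 2 + (\<Sum>n<M. (-1) ^ Suc n *
      (cos (2 * real (Suc n) * x) + sin ((2 * real (Suc n) - 1) * x)))))) \<longlonglongrightarrow> 0"
  (is "(\<lambda>M. integral _ (?K M)) \<longlonglongrightarrow> 0")
proof -
  define s where "s = (\<lambda>x::real. sin (x / 2 + pi / 4))"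
  define s' where "s' = (\<lambda>x::real. cos (x / 2 + pi / 4) / 2)"
  define g where "g = (\<lambda>x. x ^ j / (2 * s x))"
  define g' where "g' = (\<lambda>x. (real j * x ^ (j - 1) * (2 * s x) - x ^ j * (2 * s' x)) / (2 * s x)\<^sup>2)"
  have s_pos: "s x > 0" if "x \<in> {0..pi}" for x
  proof -
    have "0 < x / 2 + pi / 4" "x / 2 + pi / 4 < pi"
      using that pi_gt_zero unfolding atLeastAtMost_iff by linarith+
    then show ?thesis
      unfolding s_def by (rule sin_gt_zero)
  qed
  have s_deriv: "(s has_real_derivative s' x) (at x within {0..pi})" for x
    unfolding s_def s'_def by (auto intro!: derivative_eq_intros)
  have cont: "continuous_on {0..pi} s" "continuous_on {0..pi} s'"
    unfolding s_def s'_def by (auto intro!: continuous_intros)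
  have "(g has_real_derivative g' x) (at x within {0..pi})" if "x \<in> {0..pi}" for x
    unfolding g_def g'_def using s_pos[OF that]
    by (auto intro!: derivative_eq_intros s_deriv simp: power2_eq_square)
  moreover have "continuous_on {0..pi} g'"
    unfolding g'_def using s_pos by (intro continuous_intros cont) force
  ultimately obtain B where B:
    "\<And>w p. w > 0 \<Longrightarrow> \<bar>integral {0..pi} (\<lambda>x. g x * sin (w * x + p))\<bar> \<le> B / w"
    using oscillatory_integral_bound[of 0 pi g g'] by auto
  have "\<bar>integral {0..pi} (?K M)\<bar> \<le> B / (2 * real M + 1 / 2)" for M
  proof -
    have "?K M x = (-1) ^ M * (g x * sin ((2 * real M + 1 / 2) * x + pi / 4))"
      if "x \<in> {0..pi}" for x
    proof -
      have "?K M x = g x * (2 * s x * (1 / 2 + (\<Sum>n<M. (-1) ^ Suc n *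
               (cos (2 * real (Suc n) * x) + sin ((2 * real (Suc n) - 1) * x)))))"
        using s_pos[OF that] by (simp add: g_def)
      also have "\<dots> = g x * ((-1) ^ M * sin ((2 * real M + 1 / 2) * x + pi / 4))"
        unfolding s_def shifted_dirichlet_kernel ..
      finally show ?thesis by (simp only: mult_ac)
    qed
    then have "integral {0..pi} (?K M)
        = integral {0..pi} (\<lambda>x. (-1) ^ M * (g x * sin ((2 * real M + 1 / 2) * x + pi / 4)))"
      by (rule integral_cong)
    then have "\<bar>integral {0..pi} (?K M)\<bar>
        = \<bar>integral {0..pi} (\<lambda>x. g x * sin ((2 * real M + 1 / 2) * x + pi / 4))\<bar>"
      by (simp add: abs_mult power_abs)
    also have "\<dots> \<le> B / (2 * real M + 1 / 2)"
      by (rule B) simp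
    finally show ?thesis .
  qed
  then have "\<forall>\<^sub>F M in sequentially. norm (integral {0..pi} (?K M)) \<le> B / (2 * real M + 1 / 2)"
    unfolding real_norm_def by (intro always_eventually allI)
  moreover have "(\<lambda>M. B / (2 * real M + 1 / 2)) \<longlonglongrightarrow> 0"
    by real_asymp
  ultimately show ?thesis
    by (rule Lim_null_comparison)
qed

section \<open>Fourier coefficients of even powers\<close>

text \<open>
  Two integrations by parts lower the exponent by \<open>2\<close> and multiply the integral by \<open>-q\<close>, with
  \<open>q\<close> as in the proof; \<open>u\<close> collects the two boundary terms.  Since \<open>sin (m * pi) = 0\<close>, only
  the one with a cosine remains, and it is the new \<open>l = 0\<close> summand.
\<close>

lemma even_power_cos_integral:
  fixes m :: real
  assumes "m \<noteq> 0" and sin: "sin (m * pi) = 0"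
  shows "((\<lambda>x. x ^ (2 * k) * cos (m * x)) has_integral
           cos (m * pi) * (\<Sum>l<k. (-1) ^ l * fact (2 * k) / fact (2 * k - 2 * l - 1)
             * pi ^ (2 * k - 2 * l - 1) / m ^ (2 * l + 2))) {0..pi}"
proof (induction k)
  case 0
  have "((\<lambda>x. cos (m * x)) has_integral (sin (m * pi) / m - sin (m * 0) / m)) {0..pi}"
    using \<open>m \<noteq> 0\<close>
    by (intro fundamental_theorem_of_calculus)
       (auto intro!: derivative_eq_intros
         simp: has_real_derivative_iff_has_vector_derivative[symmetric])
  then show ?case using sin by simp
next
  case (Suc k)
  let ?f = "\<lambda>k l. (-1) ^ l * fact (2 * k) / fact (2 * k - 2 * l - 1)
             * pi ^ (2 * k - 2 * l - 1) / m ^ (2 * l + 2)"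
  define c where "c = (2 * real k + 2) * (2 * real k + 1)"
  define q where "q = c / m\<^sup>2"
  have fact_step: "fact (2 * Suc k) = c * fact (2 * k)"
    by (simp add: c_def algebra_simps)
  define u where "u = (\<lambda>x. x ^ Suc (Suc (2 * k)) * sin (m * x) / m
                        + (2 * real k + 2) * x ^ Suc (2 * k) * cos (m * x) / m\<^sup>2)"
  have "(u has_real_derivative (x ^ Suc (Suc (2 * k)) * cos (m * x) + q * (x ^ (2 * k) * cos (m * x))))
          (at x within {0..pi})" for x
  proof -
    have pow: "((\<lambda>x. x ^ Suc n) has_real_derivative real (Suc n) * x ^ n) (at x within {0..pi})" for n
      using DERIV_pow[of "Suc n" x] by simp
    have sin_deriv: "((\<lambda>x. sin (m * x)) has_real_derivative m * cos (m * x)) (at x within {0..pi})"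
      by (auto intro!: derivative_eq_intros)
    have cos_deriv: "((\<lambda>x. cos (m * x)) has_real_derivative - (m * sin (m * x))) (at x within {0..pi})"
      by (auto intro!: derivative_eq_intros)
    show ?thesis
      unfolding u_def q_def c_def
      by (rule DERIV_cong[OF DERIV_add[OF DERIV_cdivide[OF DERIV_mult[OF pow sin_deriv]]
              DERIV_cdivide[OF DERIV_mult[OF DERIV_cmult[OF pow] cos_deriv]]]])
         (use \<open>m \<noteq> 0\<close> in \<open>simp add: field_simps power2_eq_square\<close>)
  qed
  then have "((\<lambda>x. x ^ Suc (Suc (2 * k)) * cos (m * x) + q * (x ^ (2 * k) * cos (m * x)))
               has_integral (u pi - u 0)) {0..pi}"
    by (intro fundamental_theorem_of_calculus)
       (auto simp: has_real_derivative_iff_has_vector_derivative)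
  from has_integral_diff[OF this has_integral_mult_right[OF Suc.IH, of q]]
  have "((\<lambda>x. x ^ Suc (Suc (2 * k)) * cos (m * x)) has_integral
          (u pi - u 0 - q * (cos (m * pi) * (\<Sum>l<k. ?f k l)))) {0..pi}"
    by simp
  also have "u pi - u 0 - q * (cos (m * pi) * (\<Sum>l<k. ?f k l))
           = cos (m * pi) * (?f (Suc k) 0 + (\<Sum>l<k. - q * ?f k l))"
  proof -
    have "fact (2 * Suc k) = (2 * real k + 2) * fact (2 * k + 1)"
      by (simp add: algebra_simps)
    moreover have "2 * Suc k - 2 * 0 - 1 = 2 * k + 1" by simp
    ultimately have "?f (Suc k) 0 = (2 * real k + 2) * pi ^ Suc (2 * k) / m\<^sup>2"
      by (simp del: fact_Suc add: power2_eq_square)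
    then have boundary: "u pi - u 0 = cos (m * pi) * ?f (Suc k) 0"
      using sin by (simp only: u_def) simp
    show ?thesis
      unfolding boundary sum_distrib_left[symmetric] by (simp only: algebra_simps)
  qed
  also have "(\<Sum>l<k. - q * ?f k l) = (\<Sum>l<k. ?f (Suc k) (Suc l))"
  proof (intro sum.cong refl)
    fix l
    have "2 * Suc k - 2 * Suc l = 2 * k - 2 * l" by simp
    moreover have "m ^ (2 * Suc l + 2) = m\<^sup>2 * m ^ (2 * l + 2)"
      by (simp add: power2_eq_square)
    ultimately show "- q * ?f k l = ?f (Suc k) (Suc l)"
      by (simp only: fact_step q_def) (simp add: mult_ac)
  qed
  finally show ?case
    by (simp add: sum.lessThan_Suc_shift del: sum.lessThan_Suc)
qed

text \<open>
  The recursion is the one for the cosine, but now the base case leaves a boundary term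
  at \<open>0\<close>.
\<close>

lemma even_power_sin_integral:
  fixes m :: real
  assumes "m \<noteq> 0" and sin: "sin (m * pi) = 0"
  shows "((\<lambda>x. x ^ (2 * k) * sin (m * x)) has_integral
           (- cos (m * pi) * (\<Sum>l\<le>k. (-1) ^ l * fact (2 * k) / fact (2 * k - 2 * l)
             * pi ^ (2 * k - 2 * l) / m ^ (2 * l + 1))
            + (-1) ^ k * fact (2 * k) / m ^ (2 * k + 1))) {0..pi}"
proof (induction k)
  case 0
  have "((\<lambda>x. sin (m * x)) has_integral (- cos (m * pi) / m - - cos (m * 0) / m)) {0..pi}"
    using \<open>m \<noteq> 0\<close>
    by (intro fundamental_theorem_of_calculus)
       (auto intro!: derivative_eq_intros
         simp: has_real_derivative_iff_has_vector_derivative[symmetric])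
  then show ?case by simp
next
  case (Suc k)
  let ?f = "\<lambda>k l. (-1) ^ l * fact (2 * k) / fact (2 * k - 2 * l)
             * pi ^ (2 * k - 2 * l) / m ^ (2 * l + 1)"
  let ?r = "\<lambda>k. (-1) ^ k * fact (2 * k) / m ^ (2 * k + 1)"
  define c where "c = (2 * real k + 2) * (2 * real k + 1)"
  define q where "q = c / m\<^sup>2"
  have fact_step: "fact (2 * Suc k) = c * fact (2 * k)"
    by (simp add: c_def algebra_simps)
  define u where "u = (\<lambda>x. - (x ^ Suc (Suc (2 * k)) * cos (m * x)) / m
                        + (2 * real k + 2) * x ^ Suc (2 * k) * sin (m * x) / m\<^sup>2)"
  have "(u has_real_derivative (x ^ Suc (Suc (2 * k)) * sin (m * x) + q * (x ^ (2 * k) * sin (m * x))))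
          (at x within {0..pi})" for x
  proof -
    have pow: "((\<lambda>x. x ^ Suc n) has_real_derivative real (Suc n) * x ^ n) (at x within {0..pi})" for n
      using DERIV_pow[of "Suc n" x] by simp
    have sin_deriv: "((\<lambda>x. sin (m * x)) has_real_derivative m * cos (m * x)) (at x within {0..pi})"
      by (auto intro!: derivative_eq_intros)
    have cos_deriv: "((\<lambda>x. cos (m * x)) has_real_derivative - (m * sin (m * x))) (at x within {0..pi})"
      by (auto intro!: derivative_eq_intros)
    show ?thesis
      unfolding u_def q_def c_def
      by (rule DERIV_cong[OF DERIV_add[OF DERIV_cdivide[OF DERIV_minus[OF DERIV_mult[OF pow cos_deriv]]]
              DERIV_cdivide[OF DERIV_mult[OF DERIV_cmult[OF pow] sin_deriv]]]])
         (use \<open>m \<noteq> 0\<close> in \<open>simp add: field_simps power2_eq_square\<close>)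
  qed
  then have "((\<lambda>x. x ^ Suc (Suc (2 * k)) * sin (m * x) + q * (x ^ (2 * k) * sin (m * x)))
               has_integral (u pi - u 0)) {0..pi}"
    by (intro fundamental_theorem_of_calculus)
       (auto simp: has_real_derivative_iff_has_vector_derivative)
  from has_integral_diff[OF this has_integral_mult_right[OF Suc.IH, of q]]
  have "((\<lambda>x. x ^ Suc (Suc (2 * k)) * sin (m * x)) has_integral
          (u pi - u 0 - q * (- cos (m * pi) * (\<Sum>l\<le>k. ?f k l) + ?r k))) {0..pi}"
    by simp
  also have "u pi - u 0 - q * (- cos (m * pi) * (\<Sum>l\<le>k. ?f k l) + ?r k)
           = - cos (m * pi) * (?f (Suc k) 0 + (\<Sum>l\<le>k. - q * ?f k l)) + - q * ?r k"
  proof -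
    have "?f (Suc k) 0 = pi ^ Suc (Suc (2 * k)) / m" by simp
    then have boundary: "u pi - u 0 = - cos (m * pi) * ?f (Suc k) 0"
      using sin by (simp only: u_def) simp
    show ?thesis
      unfolding boundary sum_distrib_left[symmetric] by (simp only: algebra_simps)
  qed
  also have "(\<Sum>l\<le>k. - q * ?f k l) = (\<Sum>l\<le>k. ?f (Suc k) (Suc l))"
  proof (intro sum.cong refl)
    fix l
    have "2 * Suc k - 2 * Suc l = 2 * k - 2 * l" by simp
    moreover have "m ^ (2 * Suc l + 1) = m\<^sup>2 * m ^ (2 * l + 1)"
      by (simp add: power2_eq_square)
    ultimately show "- q * ?f k l = ?f (Suc k) (Suc l)"
      by (simp only: fact_step q_def) (simp add: mult_ac)
  qed
  also have "- q * ?r k = ?r (Suc k)"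
  proof -
    have "m ^ (2 * Suc k + 1) = m\<^sup>2 * m ^ (2 * k + 1)"
      by (simp add: power2_eq_square)
    then show ?thesis
      by (simp only: fact_step q_def) (simp add: mult_ac)
  qed
  finally show ?case
    by (simp add: sum.atMost_Suc_shift del: sum.atMost_Suc)
qed

section \<open>Summation of the series\<close>

text \<open>
  Integrating the kernel termwise gives the constant term plus a partial sum of this series, and
  the integral tends to \<open>0\<close>.
\<close>

lemma even_power_fourier_sums:
  "(\<lambda>n. (-1) ^ Suc n *
       ((\<Sum>l<k. (-1) ^ l * fact (2 * k) / fact (2 * k - 2 * l - 1)
            * pi ^ (2 * k - 2 * l - 1) / (2 * real (Suc n)) ^ (2 * l + 2))
        + (\<Sum>l\<le>k. (-1) ^ l * fact (2 * k) / fact (2 * k - 2 * l)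
            * pi ^ (2 * k - 2 * l) / (2 * real (Suc n) - 1) ^ (2 * l + 1))
        + (-1) ^ k * fact (2 * k) / (2 * real (Suc n) - 1) ^ (2 * k + 1)))
   sums (- (pi ^ (2 * k + 1) / (4 * real k + 2)))"
  (is "(\<lambda>n. (-1) ^ Suc n * (?C n + ?S n + ?R n)) sums _")
proof -
  let ?K = "\<lambda>M x. x ^ (2 * k) * (1 / 2 + (\<Sum>n<M. (-1) ^ Suc n *
      (cos (2 * real (Suc n) * x) + sin ((2 * real (Suc n) - 1) * x))))"
  have cos_int: "((\<lambda>x. x ^ (2 * k) * cos (2 * real (Suc n) * x)) has_integral ?C n) {0..pi}" for n
  proof -
    have "sin (2 * real (Suc n) * pi) = 0" "cos (2 * real (Suc n) * pi) = 1"
      using sin_npi[of "2 * Suc n"] cos_npi[of "2 * Suc n"] by simp_all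
    then show ?thesis
      using even_power_cos_integral[of "2 * real (Suc n)" k] by simp
  qed
  have sin_int: "((\<lambda>x. x ^ (2 * k) * sin ((2 * real (Suc n) - 1) * x)) has_integral
                   (?S n + ?R n)) {0..pi}" for n
  proof -
    have eq: "2 * real (Suc n) - 1 = real (2 * n + 1)" by simp
    have "sin ((2 * real (Suc n) - 1) * pi) = 0" "cos ((2 * real (Suc n) - 1) * pi) = -1"
      unfolding eq by (simp_all only: sin_npi cos_npi) simp
    moreover have "2 * real (Suc n) - 1 \<noteq> 0"
      unfolding eq by linarith
    ultimately show ?thesis
      using even_power_sin_integral[of "2 * real (Suc n) - 1" k] by simp
  qed
  have const_int: "((\<lambda>x. x ^ (2 * k) * (1 / 2)) has_integral pi ^ (2 * k + 1) / (4 * real k + 2)) {0..pi}"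
  proof -
    have "((\<lambda>x. x ^ (2 * k + 1) / (4 * real k + 2)) has_real_derivative x ^ (2 * k) * (1 / 2))
            (at x within {0..pi})" for x
      by (rule DERIV_cong[OF DERIV_cdivide[OF DERIV_pow]]) (simp add: divide_simps)
    then have "((\<lambda>x. x ^ (2 * k) * (1 / 2)) has_integral
            (pi ^ (2 * k + 1) / (4 * real k + 2) - 0 ^ (2 * k + 1) / (4 * real k + 2))) {0..pi}"
      by (intro fundamental_theorem_of_calculus)
         (auto simp: has_real_derivative_iff_has_vector_derivative)
    then show ?thesis by simp
  qed
  have "(?K M has_integral (pi ^ (2 * k + 1) / (4 * real k + 2)
          + (\<Sum>n<M. (-1) ^ Suc n * (?C n + ?S n + ?R n)))) {0..pi}" for M
  proof -
    have "((\<lambda>x. x ^ (2 * k) * (1 / 2) + (\<Sum>n<M. (-1) ^ Suc n *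
              (x ^ (2 * k) * cos (2 * real (Suc n) * x)
               + x ^ (2 * k) * sin ((2 * real (Suc n) - 1) * x))))
          has_integral (pi ^ (2 * k + 1) / (4 * real k + 2)
          + (\<Sum>n<M. (-1) ^ Suc n * (?C n + (?S n + ?R n))))) {0..pi}"
      by (intro has_integral_add has_integral_sum has_integral_mult_right
            const_int cos_int sin_int finite_lessThan)
    then show ?thesis
      by (simp only: distrib_left sum_distrib_left mult_ac add.assoc)
  qed
  then have "integral {0..pi} (?K M) = pi ^ (2 * k + 1) / (4 * real k + 2)
          + (\<Sum>n<M. (-1) ^ Suc n * (?C n + ?S n + ?R n))" for M
    by (rule integral_unique)
  then have "(\<lambda>M. pi ^ (2 * k + 1) / (4 * real k + 2)
          + (\<Sum>n<M. (-1) ^ Suc n * (?C n + ?S n + ?R n))) \<longlonglongrightarrow> 0"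
    using shifted_kernel_integral_tendsto_0[of "2 * k"] by (simp only:)
  from tendsto_diff[OF this tendsto_const[of "pi ^ (2 * k + 1) / (4 * real k + 2)"]]
  show ?thesis
    by (simp only: sums_def add_diff_cancel_left' diff_0)
qed

lemma summable_alternating_inverse_power:
  fixes b :: real
  assumes "b > -2" and "p > 0"
  shows "summable (\<lambda>n. (-1) ^ Suc n / (2 * real (Suc n) + b) ^ p)"
proof -
  have pos: "2 * real (Suc n) + b > 0" for n
    using \<open>b > -2\<close> by simp
  have "summable (\<lambda>n. (-1) ^ n * (1 / (2 * real (Suc n) + b) ^ p))"
  proof (rule summable_Leibniz')
    have "(\<lambda>n. inverse (2 * real (Suc n) + b)) \<longlonglongrightarrow> 0"
      by real_asymp
    from tendsto_power[OF this, of p] show "(\<lambda>n. 1 / (2 * real (Suc n) + b) ^ p) \<longlonglongrightarrow> 0"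
      using \<open>p > 0\<close> by (simp add: field_simps zero_power)
    show "0 \<le> 1 / (2 * real (Suc n) + b) ^ p" for n
      using pos[of n] by simp
    show "1 / (2 * real (Suc (Suc n)) + b) ^ p \<le> 1 / (2 * real (Suc n) + b) ^ p" for n
      using pos[of n] by (intro divide_left_mono power_mono mult_pos_pos zero_less_power) auto
  qed
  from summable_minus[OF this] show ?thesis by simp
qed

theorem theorem1p3:
  fixes k :: nat
  assumes "k \<ge> 1"
  shows "(\<forall>l\<in>{0..k-1}. summable (\<lambda>n. pi ^ (2*k - 2*l - 2) *
              (fact (2*k) * (-1) ^ Suc n * (-1) ^ l
                / (fact (2*k - 2*l - 1) * (2 * real (Suc n)) ^ (2*l + 2)))))
       \<and> (\<forall>l\<in>{0..k}. summable (\<lambda>n.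
              pi powi (2 * int k - 2 * int l - 1) * (-1) ^ Suc n * (-1) ^ l * fact (2*k)
                / ((2 * real (Suc n) - 1) ^ (2*l + 1) * fact (2*k - 2*l))))
       \<and> summable (\<lambda>n. (-1) ^ k * (-1) ^ Suc n * fact (2*k)
                / (pi * (2 * real (Suc n) - 1) ^ (2*k + 1)))
       \<and> - (1 / (4 * real k + 2)) * pi ^ (2*k) =
          (\<Sum>l=0..k-1. \<Sum>n. pi ^ (2*k - 2*l - 2) *
              (fact (2*k) * (-1) ^ Suc n * (-1) ^ l
                / (fact (2*k - 2*l - 1) * (2 * real (Suc n)) ^ (2*l + 2))))
        + (\<Sum>l=0..k. \<Sum>n.
              pi powi (2 * int k - 2 * int l - 1) * (-1) ^ Suc n * (-1) ^ l * fact (2*k)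
                / ((2 * real (Suc n) - 1) ^ (2*l + 1) * fact (2*k - 2*l)))
        + (\<Sum>n. (-1) ^ k * (-1) ^ Suc n * fact (2*k)
                / (pi * (2 * real (Suc n) - 1) ^ (2*k + 1)))"
proof -
  let ?a = "\<lambda>l n. pi ^ (2*k - 2*l - 2) *
              (fact (2*k) * (-1) ^ Suc n * (-1) ^ l
                / (fact (2*k - 2*l - 1) * (2 * real (Suc n)) ^ (2*l + 2)))"
  let ?b = "\<lambda>l n. pi powi (2 * int k - 2 * int l - 1) * (-1) ^ Suc n * (-1) ^ l * fact (2*k)
                / ((2 * real (Suc n) - 1) ^ (2*l + 1) * fact (2*k - 2*l))"
  let ?c = "\<lambda>n. (-1) ^ k * (-1) ^ Suc n * fact (2*k)
                / (pi * (2 * real (Suc n) - 1) ^ (2*k + 1))"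
  have even: "summable (\<lambda>n. (-1) ^ Suc n / (2 * real (Suc n)) ^ (2*l + 2))" for l
    using summable_alternating_inverse_power[of 0 "2*l + 2"] by simp
  have odd: "summable (\<lambda>n. (-1) ^ Suc n / (2 * real (Suc n) - 1) ^ (2*l + 1))" for l
    using summable_alternating_inverse_power[of "-1" "2*l + 1"] by simp
  have a: "summable (?a l)" for l
    using summable_mult[OF even[of l], of "pi ^ (2*k - 2*l - 2) * (fact (2*k) * (-1) ^ l
            / fact (2*k - 2*l - 1))"]
    by (simp only: times_divide_eq_left times_divide_eq_right divide_divide_eq_left mult_ac)
  have b: "summable (?b l)" for l
    using summable_mult[OF odd[of l], of "pi powi (2 * int k - 2 * int l - 1) * (-1) ^ l * fact (2*k)
            / fact (2*k - 2*l)"]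
    by (simp only: times_divide_eq_left times_divide_eq_right divide_divide_eq_left mult_ac)
  have c: "summable ?c"
    using summable_mult[OF odd[of k], of "(-1) ^ k * fact (2*k) / pi"]
    by (simp only: times_divide_eq_left times_divide_eq_right divide_divide_eq_left mult_ac)
  have ivl: "{0..k-1} = {..<k}" "{0..k} = {..k}"
    using assms by auto

  \<comment> \<open>Dividing the Fourier series by \<open>pi\<close> lowers every exponent of \<open>pi\<close> by one; for \<open>l = k\<close>
     it becomes \<open>-1\<close>, whence the integer power.\<close>
  have a_eq: "(-1) ^ Suc n * ((-1) ^ l * fact (2*k) / fact (2*k - 2*l - 1)
                * pi ^ (2*k - 2*l - 1) / (2 * real (Suc n)) ^ (2*l + 2)) / pi = ?a l n"
    if "l < k" for l n
  proof -
    have "2*k - 2*l - 1 = Suc (2*k - 2*l - 2)"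
      using that by simp
    then have "pi ^ (2*k - 2*l - 1) = pi ^ (2*k - 2*l - 2) * pi"
      by (simp only: power_Suc2)
    then show ?thesis by simp
  qed
  have b_eq: "(-1) ^ Suc n * ((-1) ^ l * fact (2*k) / fact (2*k - 2*l)
                * pi ^ (2*k - 2*l) / (2 * real (Suc n) - 1) ^ (2*l + 1)) / pi = ?b l n"
    if "l \<le> k" for l n
  proof -
    have "2 * int k - 2 * int l - 1 = int (2*k - 2*l) - 1"
      using that by simp
    then have "pi powi (2 * int k - 2 * int l - 1) = pi ^ (2*k - 2*l) / pi"
      by (simp only: power_int_diff power_int_of_nat power_int_1_right pi_neq_zero simp_thms)
    then show ?thesis by (simp add: mult_ac)
  qed
  have "(\<lambda>n. (\<Sum>l=0..k-1. ?a l n) + (\<Sum>l=0..k. ?b l n) + ?c n)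
          sums (- (pi ^ (2*k + 1) / (4 * real k + 2)) / pi)"
  proof (rule sums_cong[THEN iffD1, OF _ sums_divide[OF even_power_fourier_sums[of k], of pi]])
    fix n
    show "(-1) ^ Suc n *
       ((\<Sum>l<k. (-1) ^ l * fact (2 * k) / fact (2 * k - 2 * l - 1)
            * pi ^ (2 * k - 2 * l - 1) / (2 * real (Suc n)) ^ (2 * l + 2))
        + (\<Sum>l\<le>k. (-1) ^ l * fact (2 * k) / fact (2 * k - 2 * l)
            * pi ^ (2 * k - 2 * l) / (2 * real (Suc n) - 1) ^ (2 * l + 1))
        + (-1) ^ k * fact (2 * k) / (2 * real (Suc n) - 1) ^ (2 * k + 1)) / pi
      = (\<Sum>l=0..k-1. ?a l n) + (\<Sum>l=0..k. ?b l n) + ?c n"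
      unfolding ivl distrib_left add_divide_distrib sum_distrib_left sum_divide_distrib
      by (intro arg_cong2[where f = "(+)"] sum.cong refl a_eq b_eq) (auto simp: mult_ac)
  qed
  moreover have "(\<lambda>n. (\<Sum>l=0..k-1. ?a l n) + (\<Sum>l=0..k. ?b l n) + ?c n)
          sums ((\<Sum>l=0..k-1. \<Sum>n. ?a l n) + (\<Sum>l=0..k. \<Sum>n. ?b l n) + (\<Sum>n. ?c n))"
    by (intro sums_add sums_sum summable_sums a b c)
  ultimately have "- (pi ^ (2*k + 1) / (4 * real k + 2)) / pi
      = (\<Sum>l=0..k-1. \<Sum>n. ?a l n) + (\<Sum>l=0..k. \<Sum>n. ?b l n) + (\<Sum>n. ?c n)"
    by (rule sums_unique2)
  moreover have "- (pi ^ (2*k + 1) / (4 * real k + 2)) / pi = - (1 / (4 * real k + 2)) * pi ^ (2*k)"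
    by simp
  ultimately show ?thesis
    using a b c by (intro conjI ballI) simp_all
qed

end
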